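(* Let $n\ge1$ and $D\ge 1$ be integers, $0\le p<1$, $q=1-p$, and let $I\sim\mathcal{I}(n,D,p)$ be an Erdős--Rényi random monomial ideal in $S=\mathbb{k}[x_1,\ldots,x_n]$. For every integer $d\ge 1$, the expectation of $h_d=\dim_{\mathbb{k}}[S/I]_d$ is $$\mathbb{E}[h_d]=q^{-1}\cdot\sum_{\substack{a\in\mathbb{N}_0^n\\ |a|=d}} q^{(a_1+1)\cdots(a_n+1)-\sum_{j=D+1}^{|a|}h_{B_a}(j)},$$ where $h_{B_a}$ is the Hilbert function of $B_a=S/\langle x_1^{a_1+1},\ldots,x_n^{a_n+1}\rangle$.
   Context: $\mathbb{k}$ is an infinite field and $S$ has the standard grading $\deg x_i=1$. The distribution $\mathcal{I}(n,D,p)$: form a random set $B$ of monomials by including, independently and each with probability $p$, every non-constant monomial in $x_1,\ldots,x_n$ of total degree at most $D$; then $I=\langle B\rangle$, with $I=\langle 0\rangle$ if $B=\emptyset$. For $a=(a_1,\ldots,a_n)\in\mathbb{N}_0^n$, $|a|=a_1+\cdots+a_n$. The Hilbert function of a graded algebra $C$ is $h_C(j)=\dim_{\mathbb{k}}[C]_j$. A sum $\sum_{j=a}^{e}f(j)$ with $a>e$ is zero. *)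

theory Defs
  imports
    "HOL-Library.Poly_Mapping"
    "HOL-Algebra.QuotRing"
    "HOL-Algebra.Embedded_Algebras"
    "HOL-Algebra.Algebraic_Closure_Type"
    "HOL-Probability.Product_PMF"
begin

text \<open>
  The variables are indexed by a finite type \<open>'n\<close>, so their number is \<open>CARD('n)\<close>.
  A monomial is given by its exponent vector of type \<open>'n \<Rightarrow>\<^sub>0 nat\<close>; as \<open>'n\<close> is finite, this
  type is all of $\mathbb{N}_0^n$.
\<close>

type_synonym ('n, 'k) mpoly = "('n \<Rightarrow>\<^sub>0 nat) \<Rightarrow>\<^sub>0 'k"

abbreviation polyring :: "('n::finite, 'k::field) mpoly ring" where
  "polyring \<equiv> ring_of_type_algebra"

definition total_deg :: "('n::finite \<Rightarrow>\<^sub>0 nat) \<Rightarrow> nat" where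
  "total_deg a = (\<Sum>i\<in>UNIV. Poly_Mapping.lookup a i)"

definition monomial :: "('n::finite \<Rightarrow>\<^sub>0 nat) \<Rightarrow> ('n, 'k::field) mpoly" where
  "monomial a = Poly_Mapping.single a 1"

definition var :: "'n::finite \<Rightarrow> ('n, 'k::field) mpoly" where
  "var i = monomial (Poly_Mapping.single i 1)"

definition constants :: "('n::finite, 'k::field) mpoly set" where
  "constants = range (Poly_Mapping.single 0)"

definition homogeneous :: "nat \<Rightarrow> ('n::finite, 'k::field) mpoly set" where
  "homogeneous d = {f. \<forall>a\<in>Poly_Mapping.keys f. total_deg a = d}"

text \<open>
  For a proper ideal \<open>I\<close> the first argument of \<open>ring.dim\<close> below is the copy of the ground
  field inside \<open>S/I\<close>, and for a homogeneous \<open>I\<close> the second argument is $[S/I]_d$.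
\<close>

definition hilbert_fun :: "('n::finite, 'k::field) mpoly set \<Rightarrow> nat \<Rightarrow> nat" where
  "hilbert_fun I d =
     ring.dim (polyring Quot I)
       ((\<lambda>f. I +>\<^bsub>polyring\<^esub> f) ` constants)
       ((\<lambda>f. I +>\<^bsub>polyring\<^esub> f) ` homogeneous d)"

definition power_ideal :: "('n::finite \<Rightarrow>\<^sub>0 nat) \<Rightarrow> ('n, 'k::field) mpoly set" where
  "power_ideal a = Idl\<^bsub>polyring\<^esub> {var i ^ (Poly_Mapping.lookup a i + 1) | i. True}"

definition nonconst_monomials :: "nat \<Rightarrow> ('n::finite, 'k::field) mpoly set" where
  "nonconst_monomials D = {monomial a | a. 1 \<le> total_deg a \<and> total_deg a \<le> D}"

definition random_monomials :: "nat \<Rightarrow> real \<Rightarrow> ('n::finite, 'k::field) mpoly set pmf" where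
  "random_monomials D p =
     map_pmf (\<lambda>chosen. {m. chosen m})
       (Pi_pmf (nonconst_monomials D) False (\<lambda>_. bernoulli_pmf p))"

text \<open>The empty set generates the zero ideal.\<close>

definition er_ideal :: "nat \<Rightarrow> real \<Rightarrow> ('n::finite, 'k::field) mpoly set pmf" where
  "er_ideal D p = map_pmf (\<lambda>B. Idl\<^bsub>polyring\<^esub> B) (random_monomials D p)"

text \<open>\<open>Pi_pmf\<close> is meaningful only over a finite index set.\<close>

lemma finite_total_deg_le: "finite {a :: 'n::finite \<Rightarrow>\<^sub>0 nat. total_deg a \<le> D}"
proof -
  have "Poly_Mapping.lookup ` {a :: 'n \<Rightarrow>\<^sub>0 nat. total_deg a \<le> D} \<subseteq> (UNIV \<rightarrow>\<^sub>E {..D})"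
  proof (clarsimp simp: PiE_UNIV_domain Pi_iff)
    fix a :: "'n \<Rightarrow>\<^sub>0 nat" and i
    assume "total_deg a \<le> D"
    moreover have "Poly_Mapping.lookup a i \<le> total_deg a"
      unfolding total_deg_def by (rule member_le_sum) auto
    ultimately show "Poly_Mapping.lookup a i \<le> D" by simp
  qed
  then have "finite (Poly_Mapping.lookup ` {a :: 'n \<Rightarrow>\<^sub>0 nat. total_deg a \<le> D})"
    by (rule finite_subset) (intro finite_PiE, auto)
  then show ?thesis
    by (rule finite_imageD) (auto intro: inj_onI poly_mapping_eqI)
qed

lemma finite_nonconst_monomials:
  "finite (nonconst_monomials D :: ('n::finite, 'k::field) mpoly set)"
proof -
  have "(nonconst_monomials D :: ('n, 'k) mpoly set) \<subseteq> monomial ` {a. total_deg a \<le> D}"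
    by (auto simp: nonconst_monomials_def)
  then show ?thesis
    by (rule finite_subset) (simp add: finite_total_deg_le)
qed

end

theory Submission
  imports Defs
begin

text \<open>
  By linearity, the expected Hilbert function counts each monomial of degree \<open>d\<close> with the probability
  that it survives in the quotient by the random ideal. Two facts make this precise.

  First, an ideal generated by monomials is spanned by the multiples of its generators
  (\<open>genideal_monomials\<close>). So if \<open>1\<close> is not a generator, the remaining monomials of degree \<open>d\<close> form a
  basis of the degree \<open>d\<close> part of the quotient, and the Hilbert function counts them
  (\<open>hilbert_fun_monomial_ideal\<close>).

  Second, a monomial \<open>x\<^sup>a\<close> survives if and only if no divisor of it was chosen. The candidates are its
  divisors of degree \<open>1\<close> to \<open>D\<close>, so by independence the probability is \<open>q\<close> to the power of their
  number (\<open>prob_avoids_monomial\<close>).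

  It remains to count these divisors. There are \<open>(a\<^sub>1 + 1) \<cdots> (a\<^sub>n + 1)\<close> divisors of \<open>x\<^sup>a\<close> in all. One of
  them is the constant monomial, which accounts for the factor \<open>q\<close> that the theorem divides out. The
  divisors of degree \<open>j > D\<close> are the monomials of degree \<open>j\<close> outside the ideal of the powers
  \<open>x\<^sub>i\<close> to the \<open>a\<^sub>i + 1\<close>, and their number is the value at \<open>j\<close> of the Hilbert function of that ideal
  (\<open>hilbert_fun_power_ideal\<close>).
\<close>

section \<open>Divisibility of exponent vectors\<close>

definition divisors :: "('n::finite \<Rightarrow>\<^sub>0 nat) \<Rightarrow> ('n \<Rightarrow>\<^sub>0 nat) set" where
  "divisors a = {b. \<forall>i. Poly_Mapping.lookup b i \<le> Poly_Mapping.lookup a i}"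

definition multiples :: "('n::finite \<Rightarrow>\<^sub>0 nat) set \<Rightarrow> ('n \<Rightarrow>\<^sub>0 nat) set" where
  "multiples A = {a. divisors a \<inter> A \<noteq> {}}"

lemma divisors_refl: "a \<in> divisors a"
  by (simp add: divisors_def)

lemma divisors_add_right: "divisors b \<subseteq> divisors (a + b)"
  by (auto simp: divisors_def lookup_add intro: trans_le_add2)

lemma divisors_imp_add:
  assumes "b \<in> divisors a"
  shows "(a - b) + b = a"
  using assms by (intro poly_mapping_eqI) (simp add: divisors_def lookup_add lookup_minus)

lemma subset_multiples: "A \<subseteq> multiples A"
  using divisors_refl by (auto simp: multiples_def)

lemma single_in_divisors_iff: "Poly_Mapping.single i k \<in> divisors b \<longleftrightarrow> k \<le> Poly_Mapping.lookup b i"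
  by (auto simp: divisors_def lookup_single when_def)

lemma multiples_closed_add: "b \<in> multiples A \<Longrightarrow> a + b \<in> multiples A"
  using divisors_add_right[of b a] by (auto simp: multiples_def)

lemma total_deg_zero [simp]: "total_deg 0 = 0"
  by (simp add: total_deg_def)

lemma total_deg_eq_0_iff: "total_deg a = 0 \<longleftrightarrow> a = 0"
  by (auto simp: total_deg_def intro: poly_mapping_eqI)

lemma divisors_zero: "divisors 0 = {0}"
  by (auto simp: divisors_def intro: poly_mapping_eqI)

lemma zero_notin_multiples: "0 \<notin> A \<Longrightarrow> 0 \<notin> multiples A"
  by (simp add: multiples_def divisors_zero)

lemma total_deg_divisors_le: "b \<in> divisors a \<Longrightarrow> total_deg b \<le> total_deg a"
  by (auto simp: divisors_def total_deg_def intro: sum_mono)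

lemma finite_divisors: "finite (divisors a)"
  by (rule finite_subset[OF _ finite_total_deg_le[of "total_deg a"]])
     (auto dest: total_deg_divisors_le)

lemma card_divisors: "card (divisors a) = (\<Prod>i\<in>UNIV. Poly_Mapping.lookup a i + 1)"
proof -
  have "Poly_Mapping.lookup ` divisors a = (\<Pi>\<^sub>E i\<in>UNIV. {..Poly_Mapping.lookup a i})"
  proof (intro equalityI subsetI)
    fix g assume "g \<in> (\<Pi>\<^sub>E i\<in>UNIV. {..Poly_Mapping.lookup a i})"
    then have "\<forall>i. g i \<le> Poly_Mapping.lookup a i"
      by (auto simp: PiE_UNIV_domain Pi_iff)
    moreover have "g = Poly_Mapping.lookup (Abs_poly_mapping g)"
      by simp
    ultimately show "g \<in> Poly_Mapping.lookup ` divisors a"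
      by (intro image_eqI[where x = "Abs_poly_mapping g"]) (auto simp: divisors_def)
  qed (auto simp: divisors_def PiE_UNIV_domain)
  moreover have "inj_on Poly_Mapping.lookup (divisors a)"
    by (auto intro: inj_onI poly_mapping_eqI)
  ultimately have "card (divisors a) = card (\<Pi>\<^sub>E i\<in>UNIV. {..Poly_Mapping.lookup a i})"
    by (metis card_image)
  then show ?thesis
    by (simp add: card_PiE)
qed

text \<open>
  The divisors of \<open>a\<close> are sorted by degree: exactly one, the zero vector, has degree \<open>0\<close>, and no
  degree exceeds that of \<open>a\<close>.
\<close>

lemma card_divisors_degree_split:
  "(\<Prod>i\<in>UNIV. Poly_Mapping.lookup a i + 1) =
     1 + card {b \<in> divisors a. 1 \<le> total_deg b \<and> total_deg b \<le> D}
       + (\<Sum>j = D + 1..total_deg a. card {b \<in> divisors a. total_deg b = j})"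
proof -
  let ?M = "{b \<in> divisors a. 1 \<le> total_deg b \<and> total_deg b \<le> D}"
  let ?H = "\<Union>j\<in>{D + 1..total_deg a}. {b \<in> divisors a. total_deg b = j}"
  have split: "divisors a = insert 0 (?M \<union> ?H)"
  proof (intro equalityI subsetI)
    fix b assume "b \<in> divisors a"
    then show "b \<in> insert 0 (?M \<union> ?H)"
      using total_deg_divisors_le[of b a] total_deg_eq_0_iff[of b] by auto
  qed (auto simp: divisors_def)
  have "card ?H = (\<Sum>j = D + 1..total_deg a. card {b \<in> divisors a. total_deg b = j})"
    by (rule card_UN_disjoint) (auto simp: finite_divisors)
  moreover have "card (?M \<union> ?H) = card ?M + card ?H"
    by (rule card_Un_disjoint) (auto simp: finite_divisors)
  moreover have "card (insert 0 (?M \<union> ?H)) = Suc (card (?M \<union> ?H))"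
    by (rule card_insert_disjoint) (auto simp: finite_divisors)
  ultimately show ?thesis
    using split card_divisors[of a] by simp
qed

section \<open>Monomial ideals\<close>

definition supported_on :: "('n::finite \<Rightarrow>\<^sub>0 nat) set \<Rightarrow> ('n, 'k::field) mpoly set" where
  "supported_on U = {f. Poly_Mapping.keys f \<subseteq> U}"

lemma supported_on_simps:
  "0 \<in> supported_on U"
  "f \<in> supported_on U \<Longrightarrow> g \<in> supported_on U \<Longrightarrow> f + g \<in> supported_on U"
  "f \<in> supported_on U \<Longrightarrow> - f \<in> supported_on U"
  using keys_add[of f g] by (auto simp: supported_on_def in_keys_iff)

lemma polyring_simps [simp]:
  "carrier (polyring :: ('n::finite, 'k::field) mpoly ring) = UNIV"
  "x \<otimes>\<^bsub>(polyring :: ('n, 'k) mpoly ring)\<^esub> y = x * y"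
  "x \<oplus>\<^bsub>(polyring :: ('n, 'k) mpoly ring)\<^esub> y = x + y"
  "\<one>\<^bsub>(polyring :: ('n, 'k) mpoly ring)\<^esub> = 1"
  "\<zero>\<^bsub>(polyring :: ('n, 'k) mpoly ring)\<^esub> = 0"
  by (simp_all add: ring_of_type_algebra_def)

lemma ring_polyring: "ring (polyring :: ('n::finite, 'k::field) mpoly ring)"
  by (rule ring_from_type_algebra)

lemma cring_polyring: "cring (polyring :: ('n::finite, 'k::field) mpoly ring)"
  by (rule cring_from_type_algebra)

lemma ideal_supported_on_multiples:
  "ideal (supported_on (multiples A) :: ('n::finite, 'k::field) mpoly set) polyring"
proof (rule idealI[OF ring_polyring])
  interpret R: ring "polyring :: ('n, 'k) mpoly ring" by (rule ring_polyring)
  have "group (add_monoid (polyring :: ('n, 'k) mpoly ring))"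
    by (rule R.add.is_group)
  then show "subgroup (supported_on (multiples A) :: ('n, 'k) mpoly set) (add_monoid polyring)"
  proof (rule group.subgroupI)
    fix f :: "('n, 'k) mpoly"
    assume "f \<in> supported_on (multiples A)"
    moreover have "inv\<^bsub>add_monoid polyring\<^esub> f = - f"
      using R.minus_equality[of "- f" f] by (simp add: a_inv_def)
    ultimately show "inv\<^bsub>add_monoid polyring\<^esub> f \<in> supported_on (multiples A)"
      by (simp add: supported_on_simps)
  next
    show "supported_on (multiples A) \<noteq> ({} :: ('n, 'k) mpoly set)"
      using supported_on_simps(1) by blast
  qed (simp_all add: supported_on_simps)
  have *: "x * f \<in> supported_on (multiples A)"
    if "f \<in> supported_on (multiples A)" for f x :: "('n, 'k) mpoly"
    using that keys_mult[of x f] multiples_closed_add by (fastforce simp: supported_on_def)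
  show "x \<otimes>\<^bsub>polyring\<^esub> f \<in> supported_on (multiples A)"
    "f \<otimes>\<^bsub>polyring\<^esub> x \<in> supported_on (multiples A)"
    if "f \<in> supported_on (multiples A)" for f x :: "('n, 'k) mpoly"
    using *[OF that, of x] by (simp_all add: mult.commute)
qed

lemma sum_singles: "(\<Sum>a\<in>Poly_Mapping.keys f. Poly_Mapping.single a (Poly_Mapping.lookup f a)) = f"
  by (intro poly_mapping_eqI)
     (auto simp: lookup_sum lookup_single when_def in_keys_iff)

text \<open>
  The polynomials all of whose terms are divisible by a generator form an ideal. It is the least one
  containing the generators, since a sum of terms lies in any ideal that contains the terms.
\<close>

lemma genideal_monomials:
  "Idl\<^bsub>polyring\<^esub> (monomial ` A) = (supported_on (multiples A) :: ('n::finite, 'k::field) mpoly set)"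
proof
  interpret R: ring "polyring :: ('n, 'k) mpoly ring" by (rule ring_polyring)
  have "monomial ` A \<subseteq> (supported_on (multiples A) :: ('n, 'k) mpoly set)"
    using subset_multiples[of A] by (auto simp: supported_on_def monomial_def)
  then show "Idl\<^bsub>polyring\<^esub> (monomial ` A) \<subseteq> (supported_on (multiples A) :: ('n, 'k) mpoly set)"
    by (rule R.genideal_minimal[OF ideal_supported_on_multiples])
  let ?I = "Idl\<^bsub>polyring\<^esub> (monomial ` A) :: ('n, 'k) mpoly set"
  interpret I: ideal ?I "polyring :: ('n, 'k) mpoly ring"
    by (rule R.genideal_ideal) simp
  have single_in: "Poly_Mapping.single a c \<in> ?I" if a: "a \<in> multiples A" for a and c :: 'k
  proof -
    obtain b where b: "b \<in> divisors a" "b \<in> A"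
      using a by (auto simp: multiples_def)
    then have "monomial b \<in> ?I"
      using R.genideal_self[of "monomial ` A"] by auto
    then have "Poly_Mapping.single (a - b) c \<otimes>\<^bsub>polyring\<^esub> monomial b \<in> ?I"
      by (intro I.I_l_closed) auto
    then show ?thesis
      using divisors_imp_add[OF b(1)] by (simp add: monomial_def mult_single)
  qed
  have sums: "(\<Sum>a\<in>S. Poly_Mapping.single a (c a)) \<in> ?I"
    if "finite S" "S \<subseteq> multiples A" for S and c :: "_ \<Rightarrow> 'k"
    using that
  proof (induction S rule: finite_induct)
    case empty
    then show ?case using I.zero_closed by simp
  next
    case (insert a S)
    then show ?case
      using I.a_closed[OF single_in[of a "c a"]] by simp
  qed
  show "supported_on (multiples A) \<subseteq> ?I"
  proof
    fix f :: "('n, 'k) mpoly"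
    assume "f \<in> supported_on (multiples A)"
    then show "f \<in> ?I"
      using sums[of "Poly_Mapping.keys f" "Poly_Mapping.lookup f"]
      by (simp add: sum_singles supported_on_def)
  qed
qed

section \<open>Hilbert functions of monomial ideals\<close>

lemma coset_eq_iff:
  assumes "ideal I (polyring :: ('n::finite, 'k::field) mpoly ring)"
  shows "I +>\<^bsub>polyring\<^esub> f = I +>\<^bsub>polyring\<^esub> g \<longleftrightarrow> f - g \<in> I"
proof -
  interpret R: ring "polyring :: ('n, 'k) mpoly ring" by (rule ring_polyring)
  have "\<ominus>\<^bsub>polyring\<^esub> g = - g"
    using R.minus_equality[of "- g" g] by simp
  then have "f \<ominus>\<^bsub>polyring\<^esub> g = f - g"
    by (simp add: a_minus_def)
  then show ?thesis
    using R.quotient_eq_iff_same_a_r_cos[OF assms, of f g] by simp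
qed

lemma subfield_constants: "subfield constants (polyring :: ('n::finite, 'k::field) mpoly ring)"
proof -
  interpret R: cring "polyring :: ('n, 'k) mpoly ring" by (rule cring_polyring)
  have neg: "\<ominus>\<^bsub>polyring\<^esub> f = - f" for f :: "('n, 'k) mpoly"
    using R.minus_equality[of "- f" f] by simp
  have "subring constants (polyring :: ('n, 'k) mpoly ring)"
  proof (rule R.subringI)
    show "\<one>\<^bsub>polyring\<^esub> \<in> (constants :: ('n, 'k) mpoly set)"
      unfolding constants_def by (auto intro!: image_eqI[where x = 1])
  qed (auto simp: constants_def neg mult_single single_add[symmetric] single_uminus[symmetric])
  then have "subcring constants (polyring :: ('n, 'k) mpoly ring)"
    by (rule R.subcringI')
  moreover have "Units (polyring\<lparr>carrier := constants\<rparr>) =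
      (constants - {\<zero>\<^bsub>polyring\<^esub>} :: ('n, 'k) mpoly set)"
  proof (intro equalityI subsetI)
    fix x :: "('n, 'k) mpoly"
    assume "x \<in> constants - {\<zero>\<^bsub>polyring\<^esub>}"
    then obtain c where c: "x = Poly_Mapping.single 0 c" "x \<noteq> 0"
      by (auto simp: constants_def)
    then have "c \<noteq> 0"
      by auto
    let ?y = "Poly_Mapping.single 0 (inverse c) :: ('n, 'k) mpoly"
    have "?y \<in> constants" "?y * x = 1" "x * ?y = 1" "x \<in> constants"
      using c(1) \<open>c \<noteq> 0\<close> by (auto simp: constants_def mult_single)
    then show "x \<in> Units (polyring\<lparr>carrier := constants\<rparr>)"
      by (auto simp: Units_def)
  qed (auto simp: Units_def)
  ultimately show ?thesis
    by (rule R.subfieldI)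
qed

text \<open>
  The monomials outside a monomial ideal are independent modulo the ideal because a polynomial
  lies in the ideal only if each of its terms does. The proof adds one monomial at a time, in step
  with the recursion that defines the span of a list.
\<close>

lemma quotient_span_independent:
  fixes A :: "('n::finite \<Rightarrow>\<^sub>0 nat) set"
  defines "I \<equiv> (supported_on (multiples A) :: ('n, 'k::field) mpoly set)"
  defines "Q \<equiv> polyring Quot I"
  defines "K \<equiv> (\<lambda>f. I +>\<^bsub>polyring\<^esub> f) ` constants"
  defines "Us \<equiv> \<lambda>as. map (\<lambda>a. I +>\<^bsub>polyring\<^esub> monomial a) as"
  assumes "distinct as" and "set as \<inter> multiples A = {}"
  shows "ring.Span Q K (Us as) = (\<lambda>f. I +>\<^bsub>polyring\<^esub> f) ` supported_on (set as)"
    and "ring.independent Q K (Us as)"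
proof -
  interpret R: ring "polyring :: ('n, 'k) mpoly ring" by (rule ring_polyring)
  interpret I: ideal I "polyring :: ('n, 'k) mpoly ring"
    unfolding I_def by (rule ideal_supported_on_multiples)
  interpret Q: ring Q
    unfolding Q_def by (rule I.quotient_is_ring)
  let ?h = "\<lambda>f. I +>\<^bsub>polyring\<^esub> f"
  have hom: "?h \<in> ring_hom polyring Q"
    unfolding Q_def by (rule I.rcos_ring_hom)
  have h_carrier: "?h f \<in> carrier Q" for f
    using ring_hom_closed[OF hom, of f] by simp
  have h_term: "?h (Poly_Mapping.single 0 c) \<otimes>\<^bsub>Q\<^esub> ?h (monomial a) \<oplus>\<^bsub>Q\<^esub> ?h f
      = ?h (Poly_Mapping.single a c + f)" for a c f
    using ring_hom_mult[OF hom, of "Poly_Mapping.single 0 c" "monomial a"]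
      ring_hom_add[OF hom, of "Poly_Mapping.single a c" f]
    by (simp add: monomial_def mult_single)
  have "ring.Span Q K (Us as) = ?h ` supported_on (set as) \<and> ring.independent Q K (Us as)"
    using assms(5,6)
  proof (induction as)
    case Nil
    have "\<zero>\<^bsub>Q\<^esub> = ?h 0"
      using ring_hom_zero[OF hom R.ring_axioms Q.ring_axioms] by simp
    then show ?case
      by (simp add: Us_def supported_on_def)
  next
    case (Cons a as)
    then have Sp: "Q.Span K (Us as) = ?h ` supported_on (set as)"
      and ind: "Q.independent K (Us as)" and a: "a \<notin> set as" "a \<notin> multiples A"
      by auto
    have "Q.Span K (Us (a # as)) = ?h ` supported_on (set (a # as))"
    proof (intro equalityI subsetI)
      fix u assume "u \<in> Q.Span K (Us (a # as))"
      then obtain c f where u: "u = ?h (Poly_Mapping.single a c + f)"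
        and f: "f \<in> supported_on (set as)"
        using Sp by (auto simp: Us_def K_def constants_def Q.line_extension_mem_iff h_term)
      have "Poly_Mapping.single a c + f \<in> supported_on (set (a # as))"
        using f keys_add[of "Poly_Mapping.single a c" f]
        by (auto simp: supported_on_def split: if_splits)
      then show "u \<in> ?h ` supported_on (set (a # as))"
        using u by blast
    next
      fix u assume "u \<in> ?h ` supported_on (set (a # as))"
      then obtain f where u: "u = ?h f" and f: "f \<in> supported_on (set (a # as))"
        by blast
      let ?c = "Poly_Mapping.lookup f a"
      let ?g = "f - Poly_Mapping.single a ?c"
      have g: "?g \<in> supported_on (set as)"
        using f by (auto simp: supported_on_def in_keys_iff lookup_minus lookup_single when_def
            split: if_splits)
      have "u = ?h (Poly_Mapping.single 0 ?c) \<otimes>\<^bsub>Q\<^esub> ?h (monomial a) \<oplus>\<^bsub>Q\<^esub> ?h ?g"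
        using u by (simp add: h_term)
      moreover have "?h (Poly_Mapping.single 0 ?c) \<in> K"
        by (auto simp: K_def constants_def)
      moreover have "?h ?g \<in> Q.Span K (Us as)"
        using g Sp by blast
      ultimately have "u \<in> Q.line_extension K (?h (monomial a)) (Q.Span K (Us as))"
        unfolding Q.line_extension_mem_iff by (intro bexI)
      then show "u \<in> Q.Span K (Us (a # as))"
        by (simp add: Us_def)
    qed
    moreover have "?h (monomial a) \<notin> Q.Span K (Us as)"
    proof
      assume "?h (monomial a) \<in> Q.Span K (Us as)"
      then obtain f where f: "f \<in> supported_on (set as)" "?h (monomial a) = ?h f"
        unfolding Sp by (elim imageE)
      have "monomial a - f \<in> I"
        using f(2) coset_eq_iff[OF I.ideal_axioms] by simp
      have "Poly_Mapping.lookup f a = 0"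
        using f(1) a(1) by (auto simp: supported_on_def simp flip: not_in_keys_iff_lookup_eq_zero)
      then have "a \<in> Poly_Mapping.keys (monomial a - f)"
        by (simp add: in_keys_iff lookup_minus monomial_def)
      then show False
        using \<open>monomial a - f \<in> I\<close> a(2) by (auto simp: I_def supported_on_def)
    qed
    moreover from this have "Q.independent K (Us (a # as))"
      using Q.li_Cons[OF h_carrier _ ind] by (simp add: Us_def)
    ultimately show ?case
      by (intro conjI)
  qed
  then show "ring.Span Q K (Us as) = ?h ` supported_on (set as)"
    and "ring.independent Q K (Us as)"
    by auto
qed

text \<open>
  The monomials of degree \<open>d\<close> outside the ideal form a basis of the degree \<open>d\<close> part of the quotient.
  The generators must not include \<open>1\<close>: otherwise the quotient is the zero ring and the image of the
  constants is not a field.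
\<close>

lemma hilbert_fun_monomial_ideal:
  assumes "0 \<notin> A"
  shows "hilbert_fun (Idl\<^bsub>polyring\<^esub> (monomial ` A) :: ('n::finite, 'k::field) mpoly set) d =
           card {a. total_deg a = d \<and> a \<notin> multiples A}"
proof -
  define I where "I = (supported_on (multiples A) :: ('n, 'k) mpoly set)"
  interpret R: ring "polyring :: ('n, 'k) mpoly ring" by (rule ring_polyring)
  interpret I: ideal I "polyring :: ('n, 'k) mpoly ring"
    unfolding I_def by (rule ideal_supported_on_multiples)
  interpret Q: ring "polyring Quot I"
    by (rule I.quotient_is_ring)
  let ?h = "\<lambda>f. I +>\<^bsub>polyring\<^esub> f"
  interpret h: ring_hom_ring "polyring :: ('n, 'k) mpoly ring" "polyring Quot I" ?h
    by (rule I.rcos_ring_hom_ring)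
  have "(1 :: ('n, 'k) mpoly) \<notin> I"
    using zero_notin_multiples[OF assms] by (simp add: I_def supported_on_def)
  then have "?h 1 \<noteq> ?h 0"
    using coset_eq_iff[OF I.ideal_axioms, of 1 0] by simp
  then have "\<one>\<^bsub>polyring Quot I\<^esub> \<noteq> \<zero>\<^bsub>polyring Quot I\<^esub>"
    using h.hom_one h.hom_zero by simp
  then have K: "subfield (?h ` constants) (polyring Quot I)"
    by (rule h.img_is_subfield(2)[OF subfield_constants])
  let ?N = "{a :: 'n \<Rightarrow>\<^sub>0 nat. total_deg a = d \<and> a \<notin> multiples A}"
  have "finite ?N"
    by (rule finite_subset[OF _ finite_total_deg_le[of d]]) auto
  then obtain as where as: "set as = ?N" "distinct as"
    using finite_distinct_list by blast
  let ?Us = "map (\<lambda>a. ?h (monomial a)) as"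
  have disj: "set as \<inter> multiples A = {}"
    using as(1) by auto
  note basis = quotient_span_independent[OF as(2) disj, where 'k = 'k, folded I_def]
  \<comment> \<open>Modulo the ideal, the terms of a homogeneous polynomial that lie in the ideal may be dropped.\<close>
  have "?h ` homogeneous d = ?h ` supported_on ?N"
  proof (intro equalityI image_subsetI)
    fix f :: "('n, 'k) mpoly"
    assume f: "f \<in> homogeneous d"
    define g where "g = Abs_poly_mapping (\<lambda>a. if a \<in> ?N then Poly_Mapping.lookup f a else 0)"
    have "finite {a. (if a \<in> ?N then Poly_Mapping.lookup f a else 0) \<noteq> 0}"
      by (rule finite_subset[OF _ finite_lookup[of f]]) auto
    then have g: "Poly_Mapping.lookup g a = (if a \<in> ?N then Poly_Mapping.lookup f a else 0)" for a
      by (simp add: g_def)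
    have "Poly_Mapping.lookup f a = 0" if "total_deg a \<noteq> d" for a
      using f that by (auto simp: homogeneous_def simp flip: not_in_keys_iff_lookup_eq_zero)
    then have "f - g \<in> I"
      by (auto simp: I_def supported_on_def in_keys_iff lookup_minus g split: if_splits)
    then have "?h f = ?h g"
      using coset_eq_iff[OF I.ideal_axioms] by blast
    moreover have "g \<in> supported_on ?N"
      by (auto simp: supported_on_def in_keys_iff g split: if_splits)
    ultimately show "?h f \<in> ?h ` supported_on ?N"
      by blast
  qed (auto simp: supported_on_def homogeneous_def)
  then have "Q.dimension (length ?Us) (?h ` constants) (?h ` homogeneous d)"
    using Q.dimension_independent[OF basis(2)] basis(1) as(1) by simp
  then have "Q.dim (?h ` constants) (?h ` homogeneous d) = length ?Us"
    using Q.dimI[OF K] by (simp add: over_def)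
  then show ?thesis
    using distinct_card[OF as(2)] as(1)
    by (simp add: hilbert_fun_def genideal_monomials I_def)
qed

lemma var_power: "(var i :: ('n::finite, 'k::field) mpoly) ^ k = monomial (Poly_Mapping.single i k)"
  by (induction k) (simp_all add: var_def monomial_def mult_single single_add[symmetric])

text \<open>
  A monomial is divisible by none of the generators, the powers \<open>x\<^sub>i\<close> to the \<open>a\<^sub>i + 1\<close>, exactly if
  each of its exponents is at most \<open>a\<^sub>i\<close>, that is, if it divides \<open>x\<^sup>a\<close>.
\<close>

lemma hilbert_fun_power_ideal:
  "hilbert_fun (power_ideal a :: ('n::finite, 'k::field) mpoly set) j =
     card {b \<in> divisors a. total_deg b = j}"
proof -
  let ?A = "range (\<lambda>i. Poly_Mapping.single i (Poly_Mapping.lookup a i + 1))"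
  have "power_ideal a = Idl\<^bsub>polyring\<^esub> (monomial ` ?A :: ('n, 'k) mpoly set)"
    unfolding power_ideal_def by (rule arg_cong[where f = "genideal polyring"])
       (auto simp: var_power simp del: power_Suc)
  moreover have "0 \<notin> ?A"
    by (auto dest!: arg_cong[where f = total_deg] simp: total_deg_def lookup_single when_def)
  moreover have "b \<in> multiples ?A \<longleftrightarrow> b \<notin> divisors a" for b
  proof -
    have "b \<in> multiples ?A \<longleftrightarrow> (\<exists>i. Poly_Mapping.lookup a i + 1 \<le> Poly_Mapping.lookup b i)"
      by (simp only: multiples_def single_in_divisors_iff[symmetric]) blast
    then show ?thesis
      by (simp add: divisors_def not_le Suc_le_eq)
  qed
  then have "{b. total_deg b = j \<and> b \<notin> multiples ?A} = {b \<in> divisors a. total_deg b = j}"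
    by blast
  ultimately show ?thesis
    using hilbert_fun_monomial_ideal[of ?A j, where 'k = 'k] by metis
qed

section \<open>The random ideal\<close>

lemma monomial_inj: "inj (monomial :: ('n::finite \<Rightarrow>\<^sub>0 nat) \<Rightarrow> ('n, 'k::field) mpoly)"
proof (rule injI)
  fix a b
  assume "monomial a = (monomial b :: ('n, 'k) mpoly)"
  then have "Poly_Mapping.keys (monomial a :: ('n, 'k) mpoly)
      = Poly_Mapping.keys (monomial b :: ('n, 'k) mpoly)"
    by simp
  then show "a = b"
    by (simp add: monomial_def)
qed

lemma monomial_in_nonconst_iff:
  "(monomial a :: ('n::finite, 'k::field) mpoly) \<in> nonconst_monomials D
     \<longleftrightarrow> 1 \<le> total_deg a \<and> total_deg a \<le> D"
proof -
  have "nonconst_monomials D = (monomial ` {a. 1 \<le> total_deg a \<and> total_deg a \<le> D} :: ('n, 'k) mpoly set)"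
    by (auto simp: nonconst_monomials_def)
  then show ?thesis
    by (simp add: inj_image_mem_iff[OF monomial_inj])
qed

lemma prob_none_chosen:
  fixes p :: real
  assumes "finite A" "C \<subseteq> A" "0 \<le> p" "p \<le> 1"
  shows "measure_pmf.prob (Pi_pmf A False (\<lambda>_. bernoulli_pmf p)) {f. \<forall>x\<in>C. \<not> f x} = (1 - p) ^ card C"
proof -
  have eq: "{f. \<forall>x\<in>C. \<not> f x} = Pi A (\<lambda>x. if x \<in> C then {False} else UNIV)"
    using assms(2) by (auto simp: Pi_iff split: if_splits)
  have "measure_pmf.prob (Pi_pmf A False (\<lambda>_. bernoulli_pmf p)) {f. \<forall>x\<in>C. \<not> f x}
      = (\<Prod>x\<in>A. measure_pmf.prob (bernoulli_pmf p) (if x \<in> C then {False} else UNIV))"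
    unfolding eq by (rule measure_Pi_pmf_Pi[OF assms(1)])
  also have "\<dots> = (\<Prod>x\<in>A. if x \<in> C then 1 - p else 1)"
    using assms(3,4) by (intro prod.cong) (auto simp: measure_pmf_single)
  also have "\<dots> = (1 - p) ^ card C"
    using assms(1,2) by (simp add: prod.If_cases Int_absorb1)
  finally show ?thesis .
qed

text \<open>
  The monomial \<open>x\<^sup>a\<close> stays outside the ideal exactly if none of its divisors is chosen, and only
  the divisors of degree \<open>1\<close> to \<open>D\<close> are candidates.
\<close>

lemma prob_avoids_monomial:
  fixes p :: real and a :: "'n::finite \<Rightarrow>\<^sub>0 nat"
  assumes "0 \<le> p" "p \<le> 1"
  shows "measure_pmf.prob (random_monomials D p :: ('n, 'k::field) mpoly set pmf)
           {B. a \<notin> multiples (monomial -` B)} =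
         (1 - p) ^ card {b \<in> divisors a. 1 \<le> total_deg b \<and> total_deg b \<le> D}"
proof -
  let ?C = "{b \<in> divisors a. 1 \<le> total_deg b \<and> total_deg b \<le> D}"
  let ?N = "nonconst_monomials D :: ('n, 'k) mpoly set"
  let ?P = "Pi_pmf ?N False (\<lambda>_. bernoulli_pmf p)"
  have avoids: "a \<notin> multiples {b. f (monomial b)} \<longleftrightarrow> (\<forall>m\<in>monomial ` ?C. \<not> f m)"
    if "f \<in> set_pmf ?P" for f
  proof -
    have "f \<in> {f. \<forall>m. m \<notin> ?N \<longrightarrow> f m = False}"
      using set_Pi_pmf_subset[OF finite_nonconst_monomials] that by (rule subsetD)
    then have "1 \<le> total_deg b \<and> total_deg b \<le> D" if "f (monomial b)" for b
      using that monomial_in_nonconst_iff[of b D, where 'k = 'k] by auto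
    then show ?thesis
      by (auto simp: multiples_def)
  qed
  have "measure_pmf.prob (random_monomials D p :: ('n, 'k) mpoly set pmf)
           {B. a \<notin> multiples (monomial -` B)} =
      measure_pmf.prob ?P {f. a \<notin> multiples {b. f (monomial b)}}"
    by (simp add: random_monomials_def vimage_def)
  also have "\<dots> = measure_pmf.prob ?P {f. \<forall>m\<in>monomial ` ?C. \<not> f m}"
    by (intro measure_pmf.finite_measure_eq_AE) (simp_all add: AE_measure_pmf_iff avoids)
  also have "\<dots> = (1 - p) ^ card (monomial ` ?C :: ('n, 'k) mpoly set)"
    using assms
    by (intro prob_none_chosen finite_nonconst_monomials) (auto simp: monomial_in_nonconst_iff)
  also have "card (monomial ` ?C :: ('n, 'k) mpoly set) = card ?C"
    by (rule card_image[OF inj_on_subset[OF monomial_inj subset_UNIV]])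
  finally show ?thesis .
qed

lemma set_random_monomials:
  assumes "B \<in> set_pmf (random_monomials D p :: ('n::finite, 'k::field) mpoly set pmf)"
  shows "B \<subseteq> nonconst_monomials D"
proof -
  obtain f where B: "B = {m. f m}"
    and f: "f \<in> set_pmf (Pi_pmf (nonconst_monomials D :: ('n, 'k) mpoly set) False (\<lambda>_. bernoulli_pmf p))"
    using assms by (auto simp: random_monomials_def)
  have "f \<in> {f. \<forall>m. m \<notin> (nonconst_monomials D :: ('n, 'k) mpoly set) \<longrightarrow> f m = False}"
    using set_Pi_pmf_subset[OF finite_nonconst_monomials] f by (rule subsetD)
  then show ?thesis
    using B by auto
qed

theorem proposition3p4:
  fixes D d :: nat and p q :: real
  assumes "infinite (UNIV :: 'k::field set)"
    and "D \<ge> 1" and "0 \<le> p" and "p < 1" and "q = 1 - p" and "d \<ge> 1"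
  shows "measure_pmf.expectation (er_ideal D p :: ('n::finite, 'k) mpoly set pmf)
           (\<lambda>I. real (hilbert_fun I d)) =
         inverse q *
           (\<Sum>a | total_deg (a :: 'n \<Rightarrow>\<^sub>0 nat) = d.
              q powi (int (\<Prod>i\<in>UNIV. Poly_Mapping.lookup a i + 1)
                - int (\<Sum>j = D + 1..total_deg a.
                    hilbert_fun (power_ideal a :: ('n, 'k) mpoly set) j)))"
proof -
  \<comment> \<open>\<open>?C a\<close> consists of the divisors of \<open>a\<close> that can be generators.\<close>
  let ?R = "random_monomials D p :: ('n, 'k) mpoly set pmf"
  let ?T = "{a :: 'n \<Rightarrow>\<^sub>0 nat. total_deg a = d}"
  let ?C = "\<lambda>a. {b \<in> divisors a. 1 \<le> total_deg b \<and> total_deg b \<le> D}"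
  have fin: "finite ?T"
    by (rule finite_subset[OF _ finite_total_deg_le[of d]]) auto
  have hilbert: "real (hilbert_fun (Idl\<^bsub>polyring\<^esub> B) d) =
      (\<Sum>a\<in>?T. indicator {B. a \<notin> multiples (monomial -` B)} B)" if "B \<in> set_pmf ?R" for B
  proof -
    have sub: "B \<subseteq> nonconst_monomials D"
      using that by (rule set_random_monomials)
    then have B: "B = monomial ` (monomial -` B)"
      by (auto simp: nonconst_monomials_def)
    have "0 \<notin> (monomial -` B :: ('n \<Rightarrow>\<^sub>0 nat) set)"
      using sub monomial_in_nonconst_iff[of 0 D, where 'k = 'k] by auto
    then have "hilbert_fun (Idl\<^bsub>polyring\<^esub> B) d = card {a \<in> ?T. a \<notin> multiples (monomial -` B)}"
      using hilbert_fun_monomial_ideal[of "monomial -` B" d, where 'k = 'k] B by simp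
    also have "real \<dots> = (\<Sum>a\<in>?T. indicator {B. a \<notin> multiples (monomial -` B)} B)"
      using fin by (simp add: indicator_def sum.If_cases Int_def)
    finally show ?thesis .
  qed
  have "measure_pmf.expectation (er_ideal D p :: ('n, 'k) mpoly set pmf) (\<lambda>I. real (hilbert_fun I d))
      = measure_pmf.expectation ?R (\<lambda>B. real (hilbert_fun (Idl\<^bsub>polyring\<^esub> B) d))"
    by (simp add: er_ideal_def)
  also have "\<dots> = measure_pmf.expectation ?R
      (\<lambda>B. \<Sum>a\<in>?T. indicator {B. a \<notin> multiples (monomial -` B)} B)"
    by (rule integral_cong_AE) (auto simp: AE_measure_pmf_iff hilbert)
  also have "\<dots> = (\<Sum>a\<in>?T. measure_pmf.prob ?R {B. a \<notin> multiples (monomial -` B)})"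
    by (subst Bochner_Integration.integral_sum) (auto intro: measure_pmf.integrable_const_bound[where B = 1])
  also have "\<dots> = (\<Sum>a\<in>?T. q ^ card (?C a))"
    using assms by (simp add: prob_avoids_monomial)
  also have "\<dots> = (\<Sum>a\<in>?T. inverse q * q powi (int (\<Prod>i\<in>UNIV. Poly_Mapping.lookup a i + 1)
      - int (\<Sum>j = D + 1..total_deg a. hilbert_fun (power_ideal a :: ('n, 'k) mpoly set) j)))"
  proof (rule sum.cong)
    fix a :: "'n \<Rightarrow>\<^sub>0 nat"
    have "int (\<Prod>i\<in>UNIV. Poly_Mapping.lookup a i + 1)
        - int (\<Sum>j = D + 1..total_deg a. hilbert_fun (power_ideal a :: ('n, 'k) mpoly set) j)
        = int (Suc (card (?C a)))"
      unfolding card_divisors_degree_split[of a D] hilbert_fun_power_ideal by simp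
    then show "q ^ card (?C a) = inverse q * q powi (int (\<Prod>i\<in>UNIV. Poly_Mapping.lookup a i + 1)
        - int (\<Sum>j = D + 1..total_deg a. hilbert_fun (power_ideal a :: ('n, 'k) mpoly set) j))"
      using assms by (simp only: power_int_of_nat) simp
  qed simp
  finally show ?thesis
    by (simp add: sum_distrib_left)
qed

end
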